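(* Let $G$ be a graph on $n$ vertices with girth greater than $g+1$. Then $\operatorname{cub}(G)$ is in $O\!\left(n^{\frac{1}{\lfloor g/2\rfloor}}\log n\right)$. More precisely, $\operatorname{cub}(G)\le \left(n^{\frac{1}{\lfloor g/2\rfloor}}+2\right)\lceil 2e\log n\rceil$.
   Context: All graphs are finite, simple and undirected. The girth of a graph is the length of a smallest cycle in it, taken to be $\infty$ for acyclic graphs. A $k$-cube is a Cartesian product $[a_1,a_1+1]\times\cdots\times[a_k,a_k+1]$ of closed unit-length intervals. The cubicity $\operatorname{cub}(G)$ is the minimum positive integer $k$ such that the vertices of $G$ can be mapped to $k$-cubes in $\mathbb{R}^k$ so that two distinct vertices are adjacent in $G$ if and only if their cubes have non-empty intersection. Logarithms are to base $2$; $e$ is the base of the natural logarithm.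
   Formalization: Stated for n ≥ 2 and integers g ≥ 2: for n = 1 the right-hand side is 0 while cub(G) ≥ 1, for n = 0 the logarithm is undefined, and for g = 0 or 1 the exponent 1/⌊g/2⌋ is undefined. *)

theory Defs
  imports Complex_Main "HOL-Library.Extended_Nat" "HOL-Library.FuncSet"
    "Graph_Theory.Pair_Digraph"
begin

text \<open>
  A finite simple undirected graph is a \<^locale>\<open>pair_graph\<close>: a finite, loop-free digraph whose arcs
  are vertex pairs and form a symmetric relation, so each edge is present as two opposite arcs.
  Traversing an edge back and forth is then a \<^const>\<open>pre_digraph.cycle\<close> of length 2. The cycles of
  the undirected graph are those of length at least 3. The infimum over the empty set
  is \<open>\<infinity>\<close>, the girth of an acyclic graph.
\<close>

definition girth :: "'a pair_pre_digraph \<Rightarrow> enat" where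
  "girth G = (INF p \<in> {p. pre_digraph.cycle (with_proj G) p \<and> 3 \<le> length p}. enat (length p))"

text \<open>
  Since the dimension varies, points of \<open>k\<close>-dimensional real space are the extensional functions
  on \<open>{..<k}\<close>.
\<close>

definition is_cube :: "nat \<Rightarrow> (nat \<Rightarrow> real) set \<Rightarrow> bool" where
  "is_cube k Q \<longleftrightarrow> (\<exists>a. Q = (\<Pi>\<^sub>E i\<in>{..<k}. {a i..a i + 1}))"

definition cube_representation ::
    "'a pair_pre_digraph \<Rightarrow> nat \<Rightarrow> ('a \<Rightarrow> (nat \<Rightarrow> real) set) \<Rightarrow> bool" where
  "cube_representation G k f \<longleftrightarrow>
     (\<forall>v\<in>pverts G. is_cube k (f v)) \<and>
     (\<forall>u\<in>pverts G. \<forall>v\<in>pverts G. u \<noteq> v \<longrightarrow> ((u, v) \<in> parcs G \<longleftrightarrow> f u \<inter> f v \<noteq> {}))"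

definition cubicity :: "'a pair_pre_digraph \<Rightarrow> nat" where
  "cubicity G = (LEAST k. 0 < k \<and> (\<exists>f. cube_representation G k f))"

end

theory Submission
  imports Defs
begin

text \<open>
  Put \<open>r = \<lfloor>g/2\<rfloor>\<close> and \<open>k = \<lfloor>n powr (1/r)\<rfloor> + 1\<close>. In a graph without cycles of length at most \<open>2r\<close> the
  nonbacktracking walks of length \<open>r\<close> from a fixed vertex have distinct ends, so minimum degree above \<open>k\<close>
  would force at least \<open>k ^ r > n\<close> vertices. Hence every subgraph has a vertex of degree at most \<open>k\<close>, and the
  vertices can be ordered so that each has at most \<open>k\<close> earlier neighbours.

  Colour the vertices with \<open>m = k + 1\<close> colours. Each colour class \<open>j\<close> gives a unit interval supergraph
  in which \<open>u\<close> of colour \<open>j\<close> and a later nonneighbour \<open>v\<close> are separated as soon as neither \<open>v\<close> nor an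
  earlier neighbour of \<open>v\<close> has colour \<open>j\<close>. For a random colouring this has probability at least
  \<open>(1 - 1/m) ^ m \<ge> 1/4\<close> with \<open>j\<close> the colour of \<open>u\<close>, so \<open>t = \<lceil>2e log n\<rceil>\<close> colourings separate all
  nonadjacent pairs because \<open>(3/4) ^ t n\<^sup>2 < 1\<close>. This uses \<open>m t\<close> dimensions.
\<close>

section \<open>Nonbacktracking walks\<close>

fun nbwalk :: "('a \<Rightarrow> 'a \<Rightarrow> bool) \<Rightarrow> 'a list \<Rightarrow> bool" where
  "nbwalk E [] \<longleftrightarrow> True"
| "nbwalk E [x] \<longleftrightarrow> True"
| "nbwalk E [x, y] \<longleftrightarrow> E x y"
| "nbwalk E (x # y # z # zs) \<longleftrightarrow> E x y \<and> x \<noteq> z \<and> nbwalk E (y # z # zs)"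

lemma nbwalk_Cons:
  "nbwalk E (x # xs) \<longleftrightarrow> nbwalk E xs \<and> (xs \<noteq> [] \<longrightarrow> E x (hd xs) \<and> (tl xs \<noteq> [] \<longrightarrow> x \<noteq> hd (tl xs)))"
  by (cases xs; cases "tl xs") (auto simp: neq_Nil_conv)

lemma nbwalk_appendD1: "nbwalk E (xs @ ys) \<Longrightarrow> nbwalk E xs"
  by (induction xs) (auto simp: nbwalk_Cons hd_append tl_append split: list.splits)

lemma nbwalk_appendD2: "nbwalk E (xs @ ys) \<Longrightarrow> nbwalk E ys"
  by (induction xs) (auto simp: nbwalk_Cons)

lemma nbwalk_imp_successively: "nbwalk E xs \<Longrightarrow> successively E xs"
  by (induction E xs rule: nbwalk.induct) auto

lemma nbwalk_append:
  assumes "nbwalk E (xs @ [b])" "nbwalk E (b # ys)"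
    and "xs \<noteq> [] \<Longrightarrow> ys \<noteq> [] \<Longrightarrow> last xs \<noteq> hd ys"
  shows "nbwalk E (xs @ b # ys)"
  using assms
proof (induction xs)
  case (Cons x xs)
  show ?case
  proof (cases xs)
    case Nil
    with Cons.prems show ?thesis by (auto simp: nbwalk_Cons)
  next
    case (Cons x' xs')
    then show ?thesis using Cons.IH Cons.prems
      by (cases xs') (auto simp: nbwalk_Cons)
  qed
qed simp

lemma nbwalk_rev:
  assumes "symp E" "nbwalk E xs"
  shows "nbwalk E (rev xs)"
  using assms
proof (induction E xs rule: nbwalk.induct)
  case (4 E x y z zs)
  then have *: "nbwalk E ((rev zs @ [z]) @ [y])" by simp
  have "nbwalk E ((rev zs @ [z]) @ y # [x])"
    using * by (rule nbwalk_append) (use 4 sympD[OF 4(2)] in auto)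
  then show ?case by simp
qed (auto dest: sympD)

text \<open>In the shortest suffix with a repetition, the head recurs in a tail of distinct
  vertices, and the stretch up to that recurrence closes a cycle. Irreflexivity excludes an empty
  interior, and the ban on backtracking excludes a single interior vertex.\<close>

lemma nbwalk_not_distinct_obtains_cycle:
  assumes "irreflp E" "nbwalk E p" "\<not> distinct p"
  obtains x ys where "successively E (x # ys @ [x])" "distinct (ys @ [x])"
    "2 \<le> length ys" "length ys + 2 \<le> length p"
  using assms(2,3)
proof (induction p arbitrary: thesis)
  case (Cons x p)
  show ?case
  proof (cases "distinct p")
    case False
    have "nbwalk E p" using Cons.prems(2) by (simp add: nbwalk_Cons)
    show ?thesis
      by (rule Cons.IH[OF _ \<open>nbwalk E p\<close> False], rule Cons.prems(1)) auto
  next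
    case True
    with Cons.prems(3) obtain ys zs where p: "p = ys @ x # zs" by (auto dest: split_list)
    have nb: "nbwalk E (x # ys @ [x])"
      by (rule nbwalk_appendD1[of E _ zs]) (use Cons.prems(2) p in simp)
    have "ys \<noteq> []" using nb assms(1) by (auto dest: irreflpD)
    moreover have "ys \<noteq> [y]" for y using nb by auto
    ultimately have "2 \<le> length ys" by (cases ys; cases "tl ys") auto
    then show ?thesis
      using Cons.prems(1)[of x ys] nb True p by (auto dest: nbwalk_imp_successively)
  qed
qed simp

text \<open>The closed sequence \<open>x # ys @ [x]\<close> has \<open>length ys + 1\<close> edges,
  so \<open>l \<le> length ys\<close> forbids exactly the cycles of length at most \<open>l\<close>.
  Requiring two interior vertices discards an edge run back and forth.\<close>

definition cyclefree_upto :: "('a \<Rightarrow> 'a \<Rightarrow> bool) \<Rightarrow> nat \<Rightarrow> bool" where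
  "cyclefree_upto E l \<longleftrightarrow> (\<forall>x ys. successively E (x # ys @ [x]) \<longrightarrow> distinct (ys @ [x]) \<longrightarrow>
     2 \<le> length ys \<longrightarrow> l \<le> length ys)"

text \<open>If the walks part after a common vertex \<open>b\<close>, running back along one and
  then out along the other is nonbacktracking at \<open>b\<close>. The result repeats the common end
  vertex, so it contains a cycle, and that cycle is too short.\<close>

lemma nbwalk_unique:
  assumes E: "symp E" "irreflp E" and free: "cyclefree_upto E (2 * r)"
    and p: "nbwalk E p" and q: "nbwalk E q"
    and len: "length p = length q" "length p \<le> Suc r" "p \<noteq> []"
    and ends: "hd p = hd q" "last p = last q"
  shows "p = q"
proof (rule ccontr)
  assume "p \<noteq> q"
  from same_length_different[OF this len(1)] obtain pre x xs y ys where
    xy: "x \<noteq> y" and pq: "p = pre @ [x] @ xs" "q = pre @ [y] @ ys" by blast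
  have "pre \<noteq> []" using ends(1) xy pq by (cases pre) auto
  then obtain pre' b where pre: "pre = pre' @ [b]" by (metis append_butlast_last_id)
  have nb: "nbwalk E (b # x # xs)" "nbwalk E (b # y # ys)"
    using p q pq pre nbwalk_appendD2[of E pre'] by auto
  have "nbwalk E (rev (x # xs) @ [b])"
    using nbwalk_rev[OF E(1) nb(1)] by simp
  then have w: "nbwalk E (rev (x # xs) @ b # y # ys)"
    using nb(2) by (rule nbwalk_append) (use xy in simp)
  have "last (x # xs) = last (y # ys)" using ends(2) pq by simp
  then have "last (y # ys) \<in> set (rev (x # xs)) \<inter> set (b # y # ys)"
    by (metis IntI last_in_set list.distinct(1) list.set_intros(2) set_rev)
  then have "\<not> distinct (rev (x # xs) @ b # y # ys)"
    unfolding distinct_append by blast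
  from nbwalk_not_distinct_obtains_cycle[OF E(2) w this] obtain z zs where
    "successively E (z # zs @ [z])" "distinct (zs @ [z])" "2 \<le> length zs"
    and l: "length zs + 2 \<le> length (rev (x # xs) @ b # y # ys)" by blast
  then have "2 * r \<le> length zs" using free unfolding cyclefree_upto_def by blast
  \<comment> \<open>Each of \<open>x # xs\<close> and \<open>y # ys\<close> has at most
    \<open>r\<close> vertices, so the glued walk has at most \<open>2 * r + 1\<close> and
    \<open>length zs\<close> is at most \<open>2 * r - 1\<close>.\<close>
  then show False using l len pq pre by simp
qed

text \<open>Count the nonbacktracking walks with \<open>r\<close> edges inside \<open>S\<close> that
  end at a fixed \<open>s\<close>. Each extends at its front in at least \<open>d\<close> ways,
  because at most one of more than \<open>d\<close> neighbours is forbidden. By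
  \<open>nbwalk_unique\<close>, distinct walks start at distinct vertices of
  \<open>S\<close>.\<close>

lemma moore_bound:
  assumes E: "symp E" "irreflp E" and free: "cyclefree_upto E (2 * r)"
    and S: "finite S" "S \<noteq> {}" and deg: "\<And>v. v \<in> S \<Longrightarrow> d < card {w\<in>S. E w v}"
  shows "d ^ r \<le> card S"
proof -
  obtain s where s: "s \<in> S" using S(2) by blast
  define W where "W i = {p. nbwalk E p \<and> length p = Suc i \<and> last p = s \<and> set p \<subseteq> S}" for i
  have finW: "finite (W i)" for i
    by (rule finite_subset[OF _ finite_lists_length_eq[OF S(1), of "Suc i"]]) (auto simp: W_def)
  have "d ^ i \<le> card (W i)" for i
  proof (induction i)
    case 0
    have "[s] \<in> W 0" using s by (simp add: W_def)
    then show ?case using finW[of 0] by (metis One_nat_def Suc_leI card_gt_0_iff empty_iff power_0)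
  next
    case (Suc i)
    \<comment> \<open>The removed set holds the second vertex of \<open>p\<close>, and is empty for
      the one-vertex walk, so the first extension needs no separate case.\<close>
    define X where "X p = {w\<in>S. E w (hd p)} - set (take 1 (tl p))" for p
    have finX: "finite (X p)" for p using S(1) by (simp add: X_def)
    have X: "d \<le> card (X p)" if "p \<in> W i" for p
    proof -
      have "hd p \<in> S" using that by (auto simp: W_def length_Suc_conv)
      then have "d < card {w\<in>S. E w (hd p)}" by (rule deg)
      moreover have "card (set (take 1 (tl p))) \<le> 1" using card_length[of "take 1 (tl p)"] by simp
      ultimately show ?thesis
        using diff_card_le_card_Diff[of "set (take 1 (tl p))" "{w\<in>S. E w (hd p)}"] by (simp add: X_def)
    qed
    have "d ^ Suc i \<le> (\<Sum>p\<in>W i. d)" using Suc by (simp add: mult.commute)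
    also have "\<dots> \<le> (\<Sum>p\<in>W i. card (X p))" by (rule sum_mono) (rule X)
    also have "\<dots> = card (Sigma (W i) X)" using finW finX by simp
    also have "\<dots> \<le> card (W (Suc i))"
    proof (rule card_inj_on_le[where f = "\<lambda>(p, w). w # p"])
      have "w # p \<in> W (Suc i)" if pw: "p \<in> W i" "w \<in> X p" for p w
      proof -
        obtain x p' where p: "p = x # p'" using pw(1) by (cases p) (auto simp: W_def)
        show ?thesis using pw by (cases p') (auto simp: p W_def X_def)
      qed
      then show "(\<lambda>(p, w). w # p) ` Sigma (W i) X \<subseteq> W (Suc i)" by auto
    qed (auto simp: inj_on_def finW)
    finally show ?case .
  qed
  also have "card (W r) \<le> card S"
  proof (rule card_inj_on_le[where f = hd])
    show "inj_on hd (W r)"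
      by (rule inj_onI, rule nbwalk_unique[OF E free]) (auto simp: W_def)
    show "hd ` W r \<subseteq> S" by (auto simp: W_def length_Suc_conv)
  qed (rule S(1))
  finally show ?thesis .
qed

section \<open>Degeneracy\<close>

text \<open>A vertex of small degree is placed last, where its earlier neighbours are at most all
  its neighbours in \<open>S\<close>. Ranked above everything else, it adds no earlier neighbour to
  any other vertex.\<close>

lemma degenerate_ordering:
  assumes "finite S"
    and "\<And>T. T \<subseteq> S \<Longrightarrow> T \<noteq> {} \<Longrightarrow> \<exists>v\<in>T. card {w\<in>T. E w v} \<le> k"
  shows "\<exists>r::'a \<Rightarrow> nat. inj_on r S \<and> r ` S \<subseteq> {..<card S} \<and>
    (\<forall>v\<in>S. card {w\<in>S. E w v \<and> r w < r v} \<le> k)"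
  using assms
proof (induction "card S" arbitrary: S)
  case (Suc n)
  then have "S \<noteq> {}" by auto
  with Suc.prems obtain v where v: "v \<in> S" "card {w\<in>S. E w v} \<le> k" by blast
  let ?S = "S - {v}"
  have card: "card ?S = n" using Suc v by simp
  have "\<exists>r::'a \<Rightarrow> nat. inj_on r ?S \<and> r ` ?S \<subseteq> {..<card ?S} \<and>
    (\<forall>v\<in>?S. card {w\<in>?S. E w v \<and> r w < r v} \<le> k)"
  proof (rule Suc.hyps(1))
    show "n = card ?S" by (rule card[symmetric])
    show "finite ?S" using Suc.prems(1) by simp
    show "\<exists>v\<in>T. card {w\<in>T. E w v} \<le> k" if "T \<subseteq> ?S" "T \<noteq> {}" for T
      by (rule Suc.prems(2)) (use that in auto)
  qed
  then obtain r :: "'a \<Rightarrow> nat" where r: "inj_on r ?S" "r ` ?S \<subseteq> {..<n}"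
    "\<And>u. u \<in> ?S \<Longrightarrow> card {w\<in>?S. E w u \<and> r w < r u} \<le> k" unfolding card by blast
  let ?r = "r(v := n)"
  have "inj_on ?r S" using r(1,2) by (auto simp: inj_on_def)
  moreover have "?r ` S \<subseteq> {..<card S}" using r(2) Suc.hyps(2) by force
  moreover have "card {w\<in>S. E w u \<and> ?r w < ?r u} \<le> k" if u: "u \<in> S" for u
  proof (cases "u = v")
    case True
    have "card {w\<in>S. E w v \<and> ?r w < ?r v} \<le> card {w\<in>S. E w v}"
      by (rule card_mono) (use Suc.prems(1) in auto)
    then show ?thesis using v True by simp
  next
    case False
    then have "r u < n" using r(2) u by blast
    with False have "{w\<in>S. E w u \<and> ?r w < ?r u} = {w\<in>?S. E w u \<and> r w < r u}"
      by auto
    then show ?thesis using r(3)[of u] u False by simp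
  qed
  ultimately show ?case by blast
qed simp

section \<open>Separating pairs by random colourings\<close>

text \<open>A greedy form of the probabilistic argument: by double counting, some \<open>c\<close>
  handles at least a fraction \<open>q\<close> of the pairs still open, so every choice shrinks
  their number by the factor \<open>1 - q\<close>.\<close>

lemma covering_by_averaging:
  fixes q :: real
  assumes "finite P" "finite C" "C \<noteq> {}" "q \<le> 1"
    and sep: "\<And>p. p \<in> P \<Longrightarrow> q * card C \<le> card {c\<in>C. R c p}"
  shows "\<exists>cs. length cs = t \<and> set cs \<subseteq> C \<and>
    card {p\<in>P. \<forall>c\<in>set cs. \<not> R c p} \<le> (1 - q) ^ t * card P"
proof (induction t)
  case (Suc t)
  then obtain cs where cs: "length cs = t" "set cs \<subseteq> C"
    "card {p\<in>P. \<forall>c\<in>set cs. \<not> R c p} \<le> (1 - q) ^ t * card P" by blast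
  define Q where "Q = {p\<in>P. \<forall>c\<in>set cs. \<not> R c p}"
  have finQ: "finite Q" and QP: "Q \<subseteq> P" using assms(1) by (auto simp: Q_def)
  have "\<exists>c\<in>C. q * card Q \<le> card {p\<in>Q. R c p}"
  proof (rule ccontr)
    assume "\<not> ?thesis"
    then have "(\<Sum>c\<in>C. real (card {p\<in>Q. R c p})) < (\<Sum>c\<in>C. q * card Q)"
      using assms(2,3) by (intro sum_strict_mono) (auto simp: not_le)
    also have "\<dots> = (\<Sum>p\<in>Q. q * card C)" by simp
    also have "\<dots> \<le> (\<Sum>p\<in>Q. real (card {c\<in>C. R c p}))"
      using sep QP by (intro sum_mono) auto
    also have "\<dots> = (\<Sum>c\<in>C. real (card {p\<in>Q. R c p}))"
      using sum_multicount_gen[OF finQ assms(2), of "\<lambda>p c. R c p" "\<lambda>c. card {p\<in>Q. R c p}"]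
      by (simp flip: of_nat_sum)
    finally show False by simp
  qed
  then obtain c where c: "c \<in> C" "q * card Q \<le> card {p\<in>Q. R c p}" by blast
  have "{p\<in>P. \<forall>c\<in>set (c # cs). \<not> R c p} = Q - {p\<in>Q. R c p}" by (auto simp: Q_def)
  then have "real (card {p\<in>P. \<forall>c\<in>set (c # cs). \<not> R c p}) = card Q - real (card {p\<in>Q. R c p})"
    using finQ by (simp add: card_Diff_subset card_mono of_nat_diff)
  also have "\<dots> \<le> (1 - q) * card Q" using c(2) by (simp add: algebra_simps)
  also have "\<dots> \<le> (1 - q) * ((1 - q) ^ t * card P)"
    using cs(3) assms(4) by (intro mult_left_mono) (auto simp: Q_def)
  finally show ?case using cs c(1) by (intro exI[of _ "c # cs"]) simp
qed (auto intro!: exI[of _ "[]"])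

text \<open>The sequence equals 1/4 at \<open>m = 2\<close> and is nondecreasing by Bernoulli's
  inequality.\<close>

lemma power_one_minus_inverse_ge:
  assumes "2 \<le> m"
  shows "1 / 4 \<le> (1 - 1 / real m) ^ m"
  using assms
proof (induction m rule: dec_induct)
  case base
  show ?case by (simp add: power2_eq_square)
next
  case (step m)
  \<comment> \<open>The ratio of the bases for \<open>m + 1\<close> and \<open>m\<close> is
    \<open>m^2 / (m^2 - 1) = 1 + ?x\<close>.\<close>
  let ?x = "1 / (real m ^ 2 - 1)"
  have m: "real m \<ge> 2" and m2: "real m ^ 2 > 1"
    using step.hyps by (simp_all add: one_less_power)
  have "1 / (1 - 1 / real (Suc m)) = 1 + 1 / real m" using m by (simp add: field_simps)
  also have "\<dots> \<le> 1 + real m * ?x"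
    using m m2 by (simp add: field_simps power2_eq_square)
  also have "\<dots> \<le> (1 + ?x) ^ m"
    using m2 by (intro Bernoulli_inequality) (auto intro: order_trans[of _ 0])
  also have "1 + ?x = (1 - 1 / real (Suc m)) / (1 - 1 / real m)"
    using m m2 by (simp add: field_simps power2_eq_square)
  finally have *: "1 / (1 - 1 / real (Suc m)) \<le> ((1 - 1 / real (Suc m)) / (1 - 1 / real m)) ^ m" .
  have pos: "0 < 1 - 1 / real m" "0 < 1 - 1 / real (Suc m)" using m by simp_all
  from * have "1 / (1 - 1 / real (Suc m)) \<le> (1 - 1 / real (Suc m)) ^ m / (1 - 1 / real m) ^ m"
    unfolding power_divide .
  then have "(1 - 1 / real m) ^ m \<le> (1 - 1 / real (Suc m)) ^ Suc m"
    using pos by (simp add: divide_le_eq le_divide_eq mult_ac)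
  with step.IH show ?case by linarith
qed

text \<open>Given the colour of \<open>u\<close>, each vertex of \<open>X\<close> avoids it
  independently with probability \<open>1 - 1/m\<close>. Since \<open>card X \<le> m\<close>, all of
  them do so with probability at least \<open>(1 - 1/m) ^ m\<close>.\<close>

lemma card_colourings_avoiding:
  assumes "finite V" "u \<in> V" "X \<subseteq> V - {u}" "card X \<le> m" "2 \<le> m"
  shows "1 / 4 * card (V \<rightarrow>\<^sub>E {..<m}) \<le> card {c \<in> V \<rightarrow>\<^sub>E {..<m}. \<forall>x\<in>X. c x \<noteq> c u}"
proof -
  \<comment> \<open>The palette left to \<open>w\<close> once \<open>u\<close> has colour
    \<open>j\<close>. The good colourings are then a disjoint union of product sets, one for each
    \<open>j\<close>.\<close>
  let ?A = "\<lambda>j w. if w = u then {j} else if w \<in> X then {..<m} - {j} else {..<m}"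
  let ?r = "card (V - X - {u})"
  have finX: "finite X" using assms(1,3) finite_subset by blast
  have V: "V = insert u (X \<union> (V - X - {u}))" using assms(2,3) by blast
  have prodV: "(\<Prod>w\<in>V. f w) = f u * ((\<Prod>w\<in>X. f w) * (\<Prod>w\<in>V - X - {u}. f w))"
    for f :: "'a \<Rightarrow> nat"
  proof -
    have "(\<Prod>w\<in>V. f w) = f u * (\<Prod>w\<in>X \<union> (V - X - {u}). f w)"
      by (subst V, subst prod.insert) (use assms(1,3) finX in auto)
    also have "(\<Prod>w\<in>X \<union> (V - X - {u}). f w) = (\<Prod>w\<in>X. f w) * (\<Prod>w\<in>V - X - {u}. f w)"
      by (rule prod.union_disjoint) (use assms(1) finX in auto)
    finally show ?thesis .
  qed
  have cardA: "card (PiE V (?A j)) = (m - 1) ^ card X * m ^ ?r" if "j < m" for j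
  proof -
    have "(\<Prod>w\<in>X. card (?A j w)) = (\<Prod>w\<in>X. m - 1)"
      using assms(3) that by (intro prod.cong) auto
    moreover have "(\<Prod>w\<in>V - X - {u}. card (?A j w)) = (\<Prod>w\<in>V - X - {u}. m)"
      by (intro prod.cong) auto
    ultimately show ?thesis using assms(1) by (simp add: card_PiE prodV)
  qed
  have "{c \<in> V \<rightarrow>\<^sub>E {..<m}. \<forall>x\<in>X. c x \<noteq> c u} = (\<Union>j<m. PiE V (?A j))"
  proof (intro set_eqI iffI)
    fix c assume "c \<in> (\<Union>j<m. PiE V (?A j))"
    then obtain j where j: "j < m" "c \<in> PiE V (?A j)" by blast
    have "c u = j" using PiE_mem[OF j(2) assms(2)] by simp
    moreover have "c x \<noteq> j" if "x \<in> X" for x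
      using PiE_mem[OF j(2), of x] that assms(3) by (auto split: if_splits)
    moreover have "c w \<in> {..<m}" if "w \<in> V" for w
      using PiE_mem[OF j(2) that] j(1) by (auto split: if_splits)
    ultimately show "c \<in> {c \<in> V \<rightarrow>\<^sub>E {..<m}. \<forall>x\<in>X. c x \<noteq> c u}"
      using j(2) by (auto simp: PiE_def Pi_def)
  next
    fix c assume c: "c \<in> {c \<in> V \<rightarrow>\<^sub>E {..<m}. \<forall>x\<in>X. c x \<noteq> c u}"
    then have "c u < m" "c \<in> PiE V (?A (c u))" using assms(2) by (auto simp: PiE_def Pi_def)
    then show "c \<in> (\<Union>j<m. PiE V (?A j))" by blast
  qed
  also have "card \<dots> = (\<Sum>j<m. card (PiE V (?A j)))"
  proof (rule card_UN_disjoint)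
    show "\<forall>i\<in>{..<m}. \<forall>j\<in>{..<m}. i \<noteq> j \<longrightarrow> PiE V (?A i) \<inter> PiE V (?A j) = {}"
    proof (intro ballI impI, rule ccontr)
      fix i j assume "i \<noteq> j" "PiE V (?A i) \<inter> PiE V (?A j) \<noteq> {}"
      then obtain c where "c \<in> PiE V (?A i)" "c \<in> PiE V (?A j)" by blast
      from this[THEN PiE_mem, OF assms(2)] show False using \<open>i \<noteq> j\<close> by simp
    qed
  qed (use assms(1) in \<open>auto intro!: finite_PiE\<close>)
  also have "\<dots> = m * ((m - 1) ^ card X * m ^ ?r)" using cardA by simp
  finally have good: "card {c \<in> V \<rightarrow>\<^sub>E {..<m}. \<forall>x\<in>X. c x \<noteq> c u} = m * ((m - 1) ^ card X * m ^ ?r)" .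
  have all: "card (V \<rightarrow>\<^sub>E {..<m}) = m * (m ^ card X * m ^ ?r)"
    using assms(1) prodV[of "\<lambda>_. m"] by (simp add: card_PiE)
  have "1 / 4 \<le> (1 - 1 / real m) ^ m" using assms(5) by (rule power_one_minus_inverse_ge)
  also have "\<dots> \<le> (1 - 1 / real m) ^ card X"
    using assms(4,5) by (intro power_decreasing) auto
  also have "1 - 1 / real m = real (m - 1) / real m"
    using assms(5) by (simp add: field_simps of_nat_diff)
  finally have "1 / 4 * real m ^ card X \<le> real (m - 1) ^ card X"
    using assms(5) by (simp add: power_divide field_simps)
  then have "real m * real m ^ ?r * (1 / 4 * real m ^ card X)
      \<le> real m * real m ^ ?r * real (m - 1) ^ card X"
    by (intro mult_left_mono) auto
  then show ?thesis unfolding good all by (simp add: mult_ac)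
qed

text \<open>From \<open>2e \<ge> 5\<close> follows \<open>t \<ge> 5 log n\<close>, and
  \<open>(3/4)^5 = 243/1024 < 1/4\<close>, so \<open>(3/4)^t\<close> lies below
  \<open>(1/4)^(log n) = 1/n^2\<close>.\<close>

lemma three_quarters_power_less:
  assumes "2 \<le> n" "t = nat \<lceil>2 * exp 1 * log 2 (real n)\<rceil>"
  shows "(3 / 4) ^ t * real n ^ 2 < 1"
proof -
  let ?L = "log 2 (real n)"
  have L: "?L \<ge> 1" using assms(1) by (simp add: le_log_iff)
  \<comment> \<open>The Taylor bound \<open>1 + 1 + 1/2\<close> for \<open>exp 1\<close>.\<close>
  have e: "5 \<le> 2 * exp (1::real)" using exp_lower_Taylor_quadratic[of 1] by simp
  have "5 * ?L \<le> 2 * exp 1 * ?L" using e L by (intro mult_right_mono) auto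
  also have "\<dots> \<le> real t" unfolding assms(2) by (rule real_nat_ceiling_ge)
  finally have t: "5 * ?L \<le> real t" .
  have "(3 / 4 :: real) ^ t = (3 / 4) powr real t" by (simp add: powr_realpow)
  also have "\<dots> \<le> (3 / 4) powr (5 * ?L)" using t by (intro powr_mono') auto
  also have "\<dots> = ((3 / 4) powr 5) powr ?L" by (simp only: powr_powr)
  also have "(3 / 4 :: real) powr 5 = 243 / 1024" by (simp add: power_divide)
  also have "(243 / 1024 :: real) powr ?L < (1 / 4) powr ?L"
    using L by (intro powr_less_mono2) auto
  also have "(1 / 4 :: real) = 2 powr (- 2)" by (simp add: powr_minus power2_eq_square)
  also have "(2 powr (- 2)) powr ?L = (2 powr ?L) powr (- 2)" by (simp add: powr_powr mult.commute)
  also have "\<dots> = 1 / real n ^ 2" using assms(1) by (simp add: powr_minus divide_inverse)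
  finally show ?thesis using assms(1) by (simp add: field_simps)
qed

section \<open>Unit interval supergraphs\<close>

text \<open>Each \<open>f\<close> gives the left ends of unit intervals in one coordinate. Two such
  intervals meet iff their left ends differ by at most 1, and boxes meet iff they meet in every
  coordinate.\<close>

lemma cubicity_le:
  assumes "fs \<noteq> []"
    and "\<And>f u v. f \<in> set fs \<Longrightarrow> (u, v) \<in> parcs G \<Longrightarrow> u \<in> pverts G \<Longrightarrow> v \<in> pverts G \<Longrightarrow>
      \<bar>f u - f v :: real\<bar> \<le> 1"
    and "\<And>u v. u \<in> pverts G \<Longrightarrow> v \<in> pverts G \<Longrightarrow> u \<noteq> v \<Longrightarrow> (u, v) \<notin> parcs G \<Longrightarrow>
      \<exists>f\<in>set fs. \<bar>f u - f v\<bar> > 1"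
  shows "cubicity G \<le> length fs"
proof -
  define Q where "Q v = (\<Pi>\<^sub>E i\<in>{..<length fs}. {(fs ! i) v..(fs ! i) v + 1})" for v
  have "(Q u \<inter> Q v \<noteq> {}) \<longleftrightarrow>
      (\<forall>i<length fs. {(fs ! i) u..(fs ! i) u + 1} \<inter> {(fs ! i) v..(fs ! i) v + 1} \<noteq> {})" for u v
    unfolding Q_def by (simp add: PiE_Int PiE_eq_empty_iff Ball_def)
  moreover have "{a..a + 1} \<inter> {b..b + 1} \<noteq> {} \<longleftrightarrow> \<bar>a - b\<bar> \<le> 1" for a b :: real
    by auto
  ultimately have "(Q u \<inter> Q v \<noteq> {}) \<longleftrightarrow> (\<forall>f\<in>set fs. \<bar>f u - f v\<bar> \<le> 1)" for u v
    by (simp add: all_set_conv_all_nth)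
  then have "cube_representation G (length fs) Q"
    using assms(2,3) unfolding cube_representation_def is_cube_def
    by (auto simp: Q_def not_le[symmetric]) (metis not_le)+
  then show ?thesis using assms(1) unfolding cubicity_def
    by (intro Least_le) auto
qed

text \<open>
  The vertices of colour \<open>j\<close> lie in \<open>[0, 1)\<close>, the others in \<open>[1, 2]\<close>, so within either part all
  pairs are at distance at most 1. A vertex outside is placed as far right as its
  neighbours of colour \<open>j\<close> permit.
\<close>

definition position :: "('a \<Rightarrow> 'a \<Rightarrow> bool) \<Rightarrow> 'a set \<Rightarrow> ('a \<Rightarrow> real) \<Rightarrow> ('a \<Rightarrow> nat) \<Rightarrow> nat \<Rightarrow> 'a \<Rightarrow> real"
  where "position E V a c j x =
    (if c x = j then a x else 1 + Min (insert 1 (a ` {u\<in>V. c u = j \<and> E u x})))"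

text \<open>The only critical case is an edge between \<open>y\<close> of colour \<open>j\<close>
  and \<open>x\<close> of another colour: there \<open>M x \<le> a y\<close>, so
  \<open>1 + M x\<close> exceeds \<open>a y\<close> by at most 1.\<close>

lemma position_adjacent:
  assumes "finite V" "symp E" "a ` V \<subseteq> {0..<1}" "u \<in> V" "v \<in> V" "E u v"
  shows "\<bar>position E V a c j u - position E V a c j v\<bar> \<le> 1"
proof -
  have in01: "0 \<le> a x" "a x < 1" if "x \<in> V" for x using assms(3) that by auto
  define M where "M x = Min (insert 1 (a ` {u\<in>V. c u = j \<and> E u x}))" for x
  have M: "0 \<le> M x" "M x \<le> 1" for x
    unfolding M_def using in01 assms(1) by (auto simp: Min_le)
  have M': "M x \<le> a y" if "y \<in> V" "c y = j" "E y x" for x y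
    unfolding M_def using that assms(1) by (intro Min_le) auto
  have pos: "position E V a c j x = (if c x = j then a x else 1 + M x)" for x
    by (simp add: position_def M_def)
  have "E v u" using assms(2,6) by (rule sympD)
  show ?thesis
    using in01[OF assms(4)] in01[OF assms(5)] M[of u] M[of v]
      M'[OF assms(4) _ assms(6)] M'[OF assms(5) _ \<open>E v u\<close>]
    by (auto simp: pos abs_le_iff)
qed

text \<open>Every entry of the minimum defining the place of \<open>v\<close> exceeds
  \<open>a u\<close>. The inserted 1, the default for a vertex without neighbours in the colour
  class, does so because \<open>a u < 1\<close>.\<close>

lemma position_separated:
  assumes "finite V" "a u < 1" "c v \<noteq> c u"
    and "\<And>w. w \<in> V \<Longrightarrow> E w v \<Longrightarrow> c w = c u \<Longrightarrow> a u < a w"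
  shows "1 < position E V a c (c u) v - position E V a c (c u) u"
proof -
  have "a u < Min (insert 1 (a ` {w\<in>V. c w = c u \<and> E w v}))"
    using assms by (subst Min_gr_iff) auto
  then show ?thesis using assms(3) by (simp add: position_def)
qed

section \<open>From an ordering with few earlier neighbours to a cube representation\<close>

lemma cubicity_le_of_ordering:
  assumes G: "pair_graph G" and m: "2 \<le> m"
    and r: "inj_on r (pverts G)" "r ` pverts G \<subseteq> {..<card (pverts G)}"
    and back_deg: "\<And>v. v \<in> pverts G \<Longrightarrow> card {w\<in>pverts G. (w, v) \<in> parcs G \<and> r w < r v} < m"
    and t: "0 < t" "(3 / 4) ^ t * real (card (pverts G)) ^ 2 < 1"
  shows "cubicity G \<le> m * t"
proof -
  interpret pair_graph G by (rule G)
  define V where "V = pverts G"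
  define E where "E u v \<longleftrightarrow> (u, v) \<in> parcs G" for u v
  have finV: "finite V" using pair_finite_verts by (simp add: V_def)
  have symE: "symp E" using pair_sym_arcs by (auto simp: E_def symp_def symmetric_def sym_def)
  define P where "P = {(u, v). u \<in> V \<and> v \<in> V \<and> r u < r v \<and> \<not> E u v}"
  \<comment> \<open>Including \<open>v\<close> itself makes \<open>R c (u, v)\<close> also force
    \<open>c v \<noteq> c u\<close>. The set still has at most \<open>m\<close> elements, as
    \<open>v\<close> has fewer than \<open>m\<close> earlier neighbours.\<close>
  define B where "B v = insert v {w\<in>V. E w v \<and> r w < r v}" for v
  define C where "C = V \<rightarrow>\<^sub>E {..<m}"
  define R where "R c = (\<lambda>(u, v). \<forall>x\<in>B v. c x \<noteq> (c u :: nat))" for c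
  have PV: "P \<subseteq> V \<times> V" by (auto simp: P_def)
  have finP: "finite P" using finV PV by (auto intro: finite_subset)
  have cardP: "card P \<le> card V ^ 2"
    using card_mono[OF _ PV] finV by (simp add: card_cartesian_product power2_eq_square)
  have C: "finite C" "C \<noteq> {}"
    using finV m by (auto simp: C_def PiE_eq_empty_iff lessThan_empty_iff intro!: finite_PiE)
  have sep: "1 / 4 * card C \<le> card {c\<in>C. R c p}" if "p \<in> P" for p
  proof -
    obtain u v where p: "p = (u, v)" by fastforce
    have uv: "u \<in> V" "v \<in> V" "r u < r v" "\<not> E u v" using that p by (auto simp: P_def)
    have "card (B v) \<le> Suc (card {w\<in>V. E w v \<and> r w < r v})"
      unfolding B_def by (rule card_insert_le_m1) auto
    also have "\<dots> \<le> m" using back_deg[of v] uv by (simp add: V_def E_def Suc_le_eq)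
    finally have "card (B v) \<le> m" .
    moreover have "B v \<subseteq> V - {u}" using uv by (auto simp: B_def)
    ultimately show ?thesis
      using card_colourings_avoiding[OF finV uv(1) _ _ m] unfolding C_def R_def p by simp
  qed
  obtain cs where cs: "length cs = t" "set cs \<subseteq> C"
    "card {p\<in>P. \<forall>c\<in>set cs. \<not> R c p} \<le> (1 - 1 / 4) ^ t * card P"
    using covering_by_averaging[of P C "1 / 4" R t, OF finP C _ sep] by auto
  note cs(3)
  also have "(1 - 1 / 4) ^ t * card P \<le> (3 / 4) ^ t * real (card V) ^ 2"
    using cardP by (auto intro!: mult_mono simp flip: of_nat_power)
  also have "\<dots> < 1" using t(2) by (simp add: V_def)
  \<comment> \<open>A cardinality below 1 is zero.\<close>
  finally have "{p\<in>P. \<forall>c\<in>set cs. \<not> R c p} = {}"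
    using finP by simp
  then have cover: "\<exists>c\<in>set cs. R c p" if "p \<in> P" for p using that by blast
  \<comment> \<open>Ranks are scaled into \<open>[0, 1)\<close>, as the position lemmas
    require.\<close>
  define a where "a v = real (r v) / card V" for v
  have a01: "a ` V \<subseteq> {0..<1}"
    using r(2) by (auto simp: a_def V_def divide_less_eq)
  have a_less: "a u < a v" if "r u < r v" "u \<in> V" for u v
    using that finV by (auto simp: a_def intro!: divide_strict_right_mono simp: card_gt_0_iff)
  \<comment> \<open>One coordinate for each of the \<open>m\<close> colours in each of the
    \<open>t\<close> colourings.\<close>
  define fs where "fs = concat (map (\<lambda>c. map (position E V a c) [0..<m]) cs)"
  have len: "length fs = m * t"
    using cs(1) by (simp add: fs_def length_concat o_def sum_list_triv mult.commute)
  have sepf: "\<exists>f\<in>set fs. f v - f u > 1" if p: "(u, v) \<in> P" for u v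
  proof -
    from cover[OF p] obtain c where c: "c \<in> set cs" "R c (u, v)" by blast
    have uv: "u \<in> V" "v \<in> V" "r u < r v" using p by (auto simp: P_def)
    have "c u < m" using c(1) cs(2) uv(1) by (auto simp: C_def)
    then have "position E V a c (c u) \<in> set fs" using c(1) by (force simp: fs_def)
    moreover have "1 < position E V a c (c u) v - position E V a c (c u) u"
    proof (rule position_separated[OF finV])
      show "a u < 1" using a01 uv(1) by auto
      show "c v \<noteq> c u" using c(2) by (simp add: R_def B_def)
      fix w assume w: "w \<in> V" "E w v" "c w = c u"
      \<comment> \<open>A neighbour of \<open>v\<close> with the colour of \<open>u\<close> does not
        precede \<open>v\<close>, hence comes after \<open>u\<close>.\<close>
      then have "\<not> r w < r v" using c(2) by (auto simp: R_def B_def)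
      then show "a u < a w" using uv by (intro a_less) auto
    qed
    ultimately show ?thesis by blast
  qed
  have "cubicity G \<le> length fs"
  proof (rule cubicity_le)
    show "fs \<noteq> []" using len m t(1) by auto
    fix f u v assume "f \<in> set fs" "(u, v) \<in> parcs G" "u \<in> pverts G" "v \<in> pverts G"
    then show "\<bar>f u - f v\<bar> \<le> 1"
      using position_adjacent[OF finV symE a01] by (auto simp: fs_def V_def E_def)
  next
    fix u v assume uv: "u \<in> pverts G" "v \<in> pverts G" "u \<noteq> v" "(u, v) \<notin> parcs G"
    then have "(v, u) \<notin> parcs G" using symE by (auto simp: E_def symp_def)
    moreover have "r u \<noteq> r v" using r(1) uv by (auto dest: inj_onD)
    ultimately have "(u, v) \<in> P \<or> (v, u) \<in> P" using uv by (auto simp: P_def V_def E_def)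
    then show "\<exists>f\<in>set fs. \<bar>f u - f v\<bar> > 1" 
      using sepf[of u v] sepf[of v u] abs_ge_self by (metis abs_minus_commute less_le_trans)
  qed
  then show ?thesis by (simp add: len)
qed

section \<open>Girth\<close>

text \<open>Zipping a vertex sequence with its tail lists its consecutive pairs, which turns vertex
  sequences into the arc lists on which \<open>cycle\<close> is defined.\<close>

lemma pcas_zip: "pcas u (zip (u # xs) xs) (last (u # xs))"
  by (induction xs arbitrary: u) auto

lemma pawalk_verts_zip: "pawalk_verts u (zip (u # xs) xs) = u # xs"
  by (induction xs arbitrary: u) auto

lemma set_zip_subset_of_successively:
  "successively (\<lambda>u v. (u, v) \<in> A) (u # xs) \<Longrightarrow> set (zip (u # xs) xs) \<subseteq> A"
  by (induction xs arbitrary: u) auto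

lemma girth_le:
  assumes "pair_wf_digraph G" and succ: "successively (\<lambda>u v. (u, v) \<in> parcs G) (x # ys @ [x])"
    and "distinct (ys @ [x])" "2 \<le> length ys"
  shows "girth G \<le> enat (Suc (length ys))"
proof -
  interpret pair_wf_digraph G by fact
  let ?p = "zip (x # ys @ [x]) (ys @ [x])"
  have sub: "set ?p \<subseteq> parcs G" using succ by (rule set_zip_subset_of_successively)
  have "x \<in> pverts G" using succ by (cases ys) (auto dest: in_arcsD1)
  then have "cycle ?p"
    using sub pcas_zip[of x "ys @ [x]"] pawalk_verts_zip[of x "ys @ [x]"] assms(3)
    unfolding cycle_def awalk_def by (intro exI[of _ x]) auto
  then have "girth G \<le> enat (length ?p)"
    unfolding girth_def using assms(4) by (intro INF_lower) auto
  then show ?thesis by simp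
qed

text \<open>Otherwise the Moore bound, applied to degrees counted inside \<open>T\<close>, would
  give \<open>k ^ r \<le> card T\<close>, more than the whole graph has room for.\<close>

lemma girth_degenerate:
  assumes G: "pair_graph G" and girth: "girth G > enat (2 * r)"
    and k: "card (pverts G) < k ^ r" and T: "T \<subseteq> pverts G" "T \<noteq> {}"
  shows "\<exists>v\<in>T. card {w\<in>T. (w, v) \<in> parcs G} \<le> k"
proof (rule ccontr)
  interpret pair_graph G by (rule G)
  let ?E = "\<lambda>u v. (u, v) \<in> parcs G"
  assume "\<not> ?thesis"
  then have deg: "k < card {w\<in>T. ?E w v}" if "v \<in> T" for v using that by auto
  have finT: "finite T" using T(1) pair_finite_verts finite_subset by blast
  have "symp ?E" using pair_sym_arcs by (auto simp: symp_def symmetric_def sym_def)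
  moreover have "irreflp ?E" using pair_no_loops by (force simp: irreflp_def)
  moreover have "cyclefree_upto ?E (2 * r)"
    unfolding cyclefree_upto_def
  proof (intro allI impI)
    fix x ys assume "successively ?E (x # ys @ [x])" "distinct (ys @ [x])" "2 \<le> length ys"
    then have "girth G \<le> enat (Suc (length ys))"
      by (intro girth_le) unfold_locales
    with girth have "enat (2 * r) < enat (Suc (length ys))" by (rule less_le_trans)
    then show "2 * r \<le> length ys" by simp
  qed
  ultimately have "k ^ r \<le> card T" by (rule moore_bound[OF _ _ _ finT T(2) deg])
  also have "\<dots> \<le> card (pverts G)" using T(1) pair_finite_verts by (intro card_mono)
  finally show False using k by simp
qed

section \<open>Choice of parameters and the final bounds\<close>

lemma cubicity_bound:
  assumes G: "pair_graph G" and n: "card (pverts G) = n" "2 \<le> n"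
    and g: "2 \<le> g" "girth G > enat (g + 1)"
  shows "real (cubicity G) \<le> (real n powr (1 / real_of_int \<lfloor>real g / 2\<rfloor>) + 2)
           * real_of_int \<lceil>2 * exp 1 * log 2 (real n)\<rceil>"
proof -
  interpret pair_graph G by (rule G)
  define r where "r = g div 2"
  have r: "0 < r" "2 * r \<le> g" "\<lfloor>real g / 2\<rfloor> = int r"
    using g(1) floor_divide_of_nat_eq[of g 2] by (auto simp: r_def)
  define K where "K = real n powr (1 / real r)"
  \<comment> \<open>Adding 1 to the floor keeps \<open>K < k\<close> strict even for integral
    \<open>K\<close>, whence \<open>n = K^r < k^r\<close>. The \<open>k + 1\<close> colours number
    at most \<open>K + 2\<close>, the first factor of the bound.\<close>
  define k where "k = Suc (nat \<lfloor>K\<rfloor>)"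
  define t where "t = nat \<lceil>2 * exp 1 * log 2 (real n)\<rceil>"
  have L: "log 2 (real n) \<ge> 1" using n(2) by (simp add: le_log_iff)
  have K: "0 \<le> K" "K < real k" "real k \<le> K + 1" by (auto simp: K_def k_def) linarith+
  have "real n = K powr real r" using r(1) n(2) by (simp add: K_def powr_powr)
  also have "\<dots> < real k powr real r" using K r(1) by (intro powr_less_mono2) auto
  also have "\<dots> = real (k ^ r)" by (simp add: k_def powr_realpow)
  finally have "card (pverts G) < k ^ r" by (simp add: n(1))
  moreover have "enat (2 * r) < girth G" using g(2) r(2) by (meson enat_ord_simps(1) le_less_trans le_add1 order_trans)
  ultimately have "\<exists>ord::'a \<Rightarrow> nat. inj_on ord (pverts G) \<and> ord ` pverts G \<subseteq> {..<card (pverts G)} \<and>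
    (\<forall>v\<in>pverts G. card {w\<in>pverts G. (w, v) \<in> parcs G \<and> ord w < ord v} \<le> k)"
    by (intro degenerate_ordering[where E = "\<lambda>u v. (u, v) \<in> parcs G"] pair_finite_verts
        girth_degenerate[OF G])
  then obtain ord :: "'a \<Rightarrow> nat" where ord: "inj_on ord (pverts G)"
    "ord ` pverts G \<subseteq> {..<card (pverts G)}"
    "\<And>v. v \<in> pverts G \<Longrightarrow> card {w\<in>pverts G. (w, v) \<in> parcs G \<and> ord w < ord v} < Suc k"
    by (auto simp: less_Suc_eq_le)
  have pos: "0 < 2 * exp 1 * log 2 (real n)" using L by simp
  have "cubicity G \<le> Suc k * t"
    by (rule cubicity_le_of_ordering[OF G _ ord])
      (use pos three_quarters_power_less[OF n(2) t_def] in \<open>auto simp: k_def t_def n(1)\<close>)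
  then have "real (cubicity G) \<le> real (Suc k) * real t" by (metis of_nat_le_iff of_nat_mult)
  also have "\<dots> \<le> (K + 2) * real t" using K by (intro mult_right_mono) auto
  also have "real t = real_of_int \<lceil>2 * exp 1 * log 2 (real n)\<rceil>"
    using pos by (simp add: t_def)
  finally show ?thesis by (simp add: K_def r(3))
qed

theorem theorem24:
  shows "(\<exists>C::real. C > 0 \<and>
           (\<forall>(G :: 'a pair_pre_digraph) (g::nat) (n::nat).
              pair_graph G \<longrightarrow> card (pverts G) = n \<longrightarrow> 2 \<le> n \<longrightarrow> 2 \<le> g \<longrightarrow> girth G > enat (g + 1) \<longrightarrow>
              real (cubicity G) \<le> C * (real n powr (1 / real_of_int \<lfloor>real g / 2\<rfloor>) * log 2 (real n))))
       \<and> (\<forall>(G :: 'a pair_pre_digraph) (g::nat) (n::nat).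
              pair_graph G \<longrightarrow> card (pverts G) = n \<longrightarrow> 2 \<le> n \<longrightarrow> 2 \<le> g \<longrightarrow> girth G > enat (g + 1) \<longrightarrow>
              real (cubicity G)
                \<le> (real n powr (1 / real_of_int \<lfloor>real g / 2\<rfloor>) + 2)
                   * real_of_int \<lceil>2 * exp 1 * log 2 (real n)\<rceil>)"
proof (intro conjI exI[of _ "3 * (2 * exp 1 + 1)"] allI impI)
  fix G :: "'a pair_pre_digraph" and g n :: nat
  assume "pair_graph G" "card (pverts G) = n" "2 \<le> n" "2 \<le> g" "girth G > enat (g + 1)"
  note bound = cubicity_bound[OF this]
  let ?K = "real n powr (1 / real_of_int \<lfloor>real g / 2\<rfloor>)" and ?L = "log 2 (real n)"
  \<comment> \<open>As \<open>?K\<close> and \<open>?L\<close> are at least 1,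
    \<open>?K + 2 \<le> 3 * ?K\<close> and the ceiling is at most \<open>(2e + 1) * ?L\<close>. This
    yields the constant \<open>3 * (2e + 1)\<close>.\<close>
  have L: "?L \<ge> 1" using \<open>2 \<le> n\<close> by (simp add: le_log_iff)
  have K: "?K \<ge> 1" using \<open>2 \<le> n\<close> by (intro ge_one_powr_ge_zero) auto
  have "real_of_int \<lceil>2 * exp 1 * ?L\<rceil> \<le> 2 * exp 1 * ?L + 1" by linarith
  also have "\<dots> \<le> (2 * exp 1 + 1) * ?L" using L by (simp add: algebra_simps)
  finally have ceil: "real_of_int \<lceil>2 * exp 1 * ?L\<rceil> \<le> (2 * exp 1 + 1) * ?L" .
  note bound
  also have "(?K + 2) * real_of_int \<lceil>2 * exp 1 * ?L\<rceil> \<le> (3 * ?K) * ((2 * exp 1 + 1) * ?L)"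
    using K L ceil by (intro mult_mono) (auto intro: less_le_trans[of _ 0])
  finally show "real (cubicity G) \<le> 3 * (2 * exp 1 + 1) * (?K * ?L)" by (simp only: mult_ac)
qed (use cubicity_bound in \<open>auto simp: add_pos_pos\<close>)

end
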